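(* For all real $\ell\ge1$, all integers $m\ge2$ and all real $\mu>0$, $$CEI_2>CEI_1>CEI_0,$$ where $CEI_0=2^{1/\mathcal C_0}$, $CEI_1=4^{1/\mathcal C_1}$, $CEI_2=6^{1/\mathcal C_2}$ and $$\mathcal C_0=m(m+2)\mu+\tfrac m6(2m^2+3m-5)+\tfrac{\ell m}{2}(3m+1),$$ $$\mathcal C_1=2m(m+1)\mu+\tfrac m3(2m^2+3m-5)+\ell m(3m+1),$$ $$\mathcal C_2=m(2m+3)\mu+\tfrac m3(2m^2+6m-8)+\ell m(3m+2).$$
   Context: The computational efficiency index of an iterative method of order $\rho$ with computational cost per iteration $\mathcal C(\mu,m,\ell)$ is $CEI=\rho^{1/\mathcal C}$. Here $m$ is the dimension of the nonlinear system, $\mu>0$ is the cost of a scalar function evaluation measured in products, and $\ell\ge1$ is the cost of a quotient measured in products. The indices $0,1,2$ refer to three derivative-free methods of orders $2$, $4$ and $6$ (the divided-difference Newton method and two divided-difference Ostrowski-type methods), whose costs are the $\mathcal C_k$ given in the claim. *)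

theory Defs
  imports Complex_Main
begin

definition CEI :: "real \<Rightarrow> real \<Rightarrow> real" where
  "CEI \<rho> C = \<rho> powr (1 / C)"

text \<open>
  Costs per iteration, measured in products, for a system of dimension \<open>m\<close>, when a scalar function
  evaluation costs \<open>\<mu>\<close> products and a quotient costs \<open>l\<close> products. Index 0: divided-difference
  Newton method; indices 1 and 2: divided-difference Ostrowski-type methods.
\<close>

definition cost0 :: "real \<Rightarrow> nat \<Rightarrow> real \<Rightarrow> real" where
  "cost0 \<mu> m l = real m * (real m + 2) * \<mu>
     + real m / 6 * (2 * real m ^ 2 + 3 * real m - 5)
     + l * real m / 2 * (3 * real m + 1)"

definition cost1 :: "real \<Rightarrow> nat \<Rightarrow> real \<Rightarrow> real" where
  "cost1 \<mu> m l = 2 * real m * (real m + 1) * \<mu>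
     + real m / 3 * (2 * real m ^ 2 + 3 * real m - 5)
     + l * real m * (3 * real m + 1)"

definition cost2 :: "real \<Rightarrow> nat \<Rightarrow> real \<Rightarrow> real" where
  "cost2 \<mu> m l = real m * (2 * real m + 3) * \<mu>
     + real m / 3 * (2 * real m ^ 2 + 6 * real m - 8)
     + l * real m * (3 * real m + 2)"

definition CEI0 :: "real \<Rightarrow> nat \<Rightarrow> real \<Rightarrow> real" where
  "CEI0 \<mu> m l = CEI 2 (cost0 \<mu> m l)"

definition CEI1 :: "real \<Rightarrow> nat \<Rightarrow> real \<Rightarrow> real" where
  "CEI1 \<mu> m l = CEI 4 (cost1 \<mu> m l)"

definition CEI2 :: "real \<Rightarrow> nat \<Rightarrow> real \<Rightarrow> real" where
  "CEI2 \<mu> m l = CEI 6 (cost2 \<mu> m l)"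

end

theory Submission
  imports Defs
begin

text \<open>
  Raising the order from \<open>a\<close> to \<open>b \<ge> a powr s\<close> pays off as soon as the cost grows by a factor
  less than \<open>s\<close> (\<open>CEI_less\<close>), so both inequalities reduce to linear comparisons of costs.

  From order 2 to order 4 the factor is \<open>s = 2\<close>, and twice the cost of the Newton method exceeds
  the cost of the fourth-order method by \<open>2 m \<mu>\<close>.

  From order 4 to order 6 the largest admissible factor is \<open>ln 6 / ln 4\<close>, about 1.29. Replacing
  it by \<open>5/4\<close> (that is, \<open>4^5 < 6^4\<close>) keeps the coefficients rational, and it is still enough:
  the difference \<open>5 * cost1 - 4 * cost2\<close> has the factorization
  \<open>m (m - 1) (2 \<mu> + (2 m - 7) / 3 + 3 l)\<close>, where \<open>(2 m - 7) / 3 \<ge> -1\<close> for \<open>m \<ge> 2\<close> and is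
  outweighed by \<open>3 l \<ge> 3\<close>.
\<close>

text \<open>
  The chain is \<open>a powr (1/C) < a powr (s/D) = (a powr s) powr (1/D) \<le> b powr (1/D)\<close>.
\<close>
lemma CEI_less:
  assumes "1 < a" and "0 < C" and "0 < D" and order: "a powr s \<le> b" and cost: "D < s * C"
  shows "CEI a C < CEI b D"
proof -
  have "1 / C < s / D"
    using assms by (simp add: field_simps)
  then have "a powr (1 / C) < a powr (s / D)"
    using \<open>1 < a\<close> by simp
  also have "\<dots> = (a powr s) powr (1 / D)"
    by (simp add: powr_powr)
  also have "\<dots> \<le> b powr (1 / D)"
    using \<open>0 < D\<close> order by (intro powr_mono2) auto
  finally show ?thesis
    by (simp add: CEI_def)
qed

lemma four_powr_five_fourths_le_six: "4 powr (5 / 4) \<le> (6 :: real)"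
proof (rule power_le_imp_le_base)
  have "(4 powr (5 / 4)) ^ Suc 3 = (4 :: real) powr 5"
    by (simp add: powr_power)
  also have "\<dots> = 4 ^ 5"
    by (simp add: powr_numeral)
  also have "\<dots> \<le> 6 ^ Suc 3"
    by simp
  finally show "(4 powr (5 / 4)) ^ Suc 3 \<le> (6 :: real) ^ Suc 3" .
qed simp

lemma two_cost0_eq: "2 * cost0 \<mu> m l = cost1 \<mu> m l + 2 * real m * \<mu>"
  by (simp add: cost0_def cost1_def field_simps)

lemma cost2_eq: "cost2 \<mu> m l = cost1 \<mu> m l + real m * (\<mu> + (real m - 1) + l)"
  by (simp add: cost1_def cost2_def field_simps power2_eq_square)

lemma five_cost1_minus_four_cost2:
  "5 * cost1 \<mu> m l - 4 * cost2 \<mu> m l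
     = real m * (real m - 1) * (2 * \<mu> + (2 * real m - 7) / 3 + 3 * l)"
  by (simp add: cost1_def cost2_def field_simps power2_eq_square)

lemma cost1_pos:
  assumes "0 \<le> l" and "1 \<le> m" and "0 < \<mu>"
  shows "0 < cost1 \<mu> m l"
proof -
  have "2 * real m ^ 2 + 3 * real m - 5 = (real m - 1) * (2 * real m + 5)"
    by (simp add: algebra_simps power2_eq_square)
  also have "\<dots> \<ge> 0"
    using assms by simp
  finally show ?thesis
    unfolding cost1_def using assms by (intro add_pos_nonneg mult_pos_pos mult_nonneg_nonneg) auto
qed

theorem theorem3p1:
  fixes l \<mu> :: real and m :: nat
  assumes "l \<ge> 1" and "m \<ge> 2" and "\<mu> > 0"
  shows "CEI2 \<mu> m l > CEI1 \<mu> m l \<and> CEI1 \<mu> m l > CEI0 \<mu> m l"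
proof
  have m: "real m \<ge> 2"
    using \<open>m \<ge> 2\<close> by simp
  have pos1: "0 < cost1 \<mu> m l"
    using assms by (intro cost1_pos) auto
  have "0 < real m * \<mu>"
    using m \<open>\<mu> > 0\<close> by simp
  then have pos0: "0 < cost0 \<mu> m l" and less01: "cost1 \<mu> m l < 2 * cost0 \<mu> m l"
    using pos1 two_cost0_eq[of \<mu> m l] by linarith+
  have "0 < real m * (\<mu> + (real m - 1) + l)"
    using m assms by (intro mult_pos_pos) linarith+
  then have pos2: "0 < cost2 \<mu> m l"
    using pos1 cost2_eq[of \<mu> m l] by linarith
  have "0 < real m * (real m - 1) * (2 * \<mu> + (2 * real m - 7) / 3 + 3 * l)"
    using m assms by (intro mult_pos_pos) (linarith | simp add: field_simps)+
  then have less12: "cost2 \<mu> m l < 5 / 4 * cost1 \<mu> m l"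
    using five_cost1_minus_four_cost2[of \<mu> m l] by linarith
  show "CEI2 \<mu> m l > CEI1 \<mu> m l"
    unfolding CEI1_def CEI2_def
    using pos1 pos2 four_powr_five_fourths_le_six less12 by (intro CEI_less) auto
  show "CEI1 \<mu> m l > CEI0 \<mu> m l"
    unfolding CEI0_def CEI1_def
    using pos0 pos1 less01 by (intro CEI_less[where s = 2]) auto
qed

end
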